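(* Let $(\sqsubseteq,x_0)$ be a reduction concept on $\omega^\omega$ such that $\sqsubseteq$ extends Turing reducibility $\leq_T$ (i.e. $x\leq_T y$ implies $x\sqsubseteq y$) and such that whenever $f,g\sqsubseteq h$ then $f\circ g\sqsubseteq h$. Then all of the following inclusions hold: $$\emptyset\subseteq\mathcal B_\sqsubseteq(\in^* )\subseteq\mathcal B_\sqsubseteq(\leq^* )\subseteq\mathcal B_\sqsubseteq(\neq^* )\subseteq\mathcal D_\sqsubseteq(\in^* )\subseteq\omega^\omega\setminus\{x\mid x\sqsubseteq x_0\},$$ $$\mathcal B_\sqsubseteq(\in^* )\subseteq\mathcal D_\sqsubseteq(\neq^* )\subseteq\mathcal D_\sqsubseteq(\leq^* )\subseteq\mathcal D_\sqsubseteq(\in^* ),\qquad \mathcal B_\sqsubseteq(\leq^* )\subseteq\mathcal D_\sqsubseteq(\leq^* ).$$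
   Context: A reduction concept on a nonempty set $X$ is a pair $(\sqsubseteq,x_0)$ where $\sqsubseteq$ is a partial pre-order on $X$ and $x_0\in X$ is a distinguished element. An element $z\in X$ is basic if $z\sqsubseteq x_0$. For a binary relation $R$, $$\mathcal B_\sqsubseteq(R)=\{x\in X\mid\exists y\sqsubseteq x\ \forall z\sqsubseteq x_0\ [z\,R\,y]\},\qquad \mathcal D_\sqsubseteq(R)=\{x\in X\mid\exists y\sqsubseteq x\ \forall z\sqsubseteq x_0\ [\neg\, y\,R\,z]\}.$$ For $f,g\in\omega^\omega$: $f\leq^* g$ means $f(n)\leq g(n)$ for all but finitely many $n$; $f\neq^* g$ means $f(n)\neq g(n)$ for all but finitely many $n$. A slalom is a function $\sigma:\omega\to[\omega]^{<\omega}$ with $|\sigma(n)|\leq n$ for all $n$; $f\in^*\sigma$ means $f(n)\in\sigma(n)$ for all but finitely many $n$. Slaloms are identified with reals via a fixed computable coding, so that $\sqsubseteq$ applies to them. Thus $\mathcal B_\sqsubseteq(\in^* )$ is the set of $x$ such that some slalom $\sigma\sqsubseteq x$ satisfies $z\in^*\sigma$ for all basic $z\in\omega^\omega$, and $\mathcal D_\sqsubseteq(\in^* )$ is the set of $x$ such that some $y\in\omega^\omega$, $y\sqsubseteq x$, satisfies $y\notin^*\sigma$ (i.e. not $y\in^*\sigma$) for all basic slaloms $\sigma$. *)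

theory Defs
  imports Main "HOL-Library.Nat_Bijection"
begin

section \<open>Turing reducibility on Baire space\<close>

text \<open>
  Partial recursive functionals with one function oracle, as Kleene programs acting on argument
  lists. Programs carry no arity; applied to an argument list of the wrong shape they simply have
  no value.
\<close>

datatype recf =
    Zero
  | Succ
  | Proj nat
  | Oracle
  | Comp recf "recf list"
  | PrimRec recf recf
  | Mu recf

text \<open>
  \<open>eval g p xs y\<close>: with oracle \<open>g\<close>, program \<open>p\<close> halts on input \<open>xs\<close> with output \<open>y\<close>.
  The premise on the \<open>m < n\<close> in the last rule is the usual convention that an unbounded search
  diverges as soon as one of the earlier values is undefined.
\<close>

inductive eval :: "(nat \<Rightarrow> nat) \<Rightarrow> recf \<Rightarrow> nat list \<Rightarrow> nat \<Rightarrow> bool" for g where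
  Zero: "eval g Zero xs 0"
| Succ: "eval g Succ [x] (Suc x)"
| Proj: "i < length xs \<Longrightarrow> eval g (Proj i) xs (xs ! i)"
| Oracle: "eval g Oracle [x] (g x)"
| Comp: "list_all2 (\<lambda>q y. eval g q xs y) qs ys \<Longrightarrow> eval g p ys z \<Longrightarrow> eval g (Comp p qs) xs z"
| PrimRec_0: "eval g p xs y \<Longrightarrow> eval g (PrimRec p q) (0 # xs) y"
| PrimRec_Suc: "eval g (PrimRec p q) (n # xs) y \<Longrightarrow> eval g q (n # y # xs) z \<Longrightarrow>
    eval g (PrimRec p q) (Suc n # xs) z"
| Mu: "eval g p (n # xs) 0 \<Longrightarrow> (\<And>m. m < n \<Longrightarrow> \<exists>y. eval g p (m # xs) (Suc y)) \<Longrightarrow>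
    eval g (Mu p) xs n"

inductive_cases eval_ZeroE: "eval g Zero xs y"
inductive_cases eval_SuccE: "eval g Succ xs y"
inductive_cases eval_ProjE: "eval g (Proj i) xs y"
inductive_cases eval_OracleE: "eval g Oracle xs y"
inductive_cases eval_CompE: "eval g (Comp p qs) xs y"
inductive_cases eval_PrimRec_0E: "eval g (PrimRec p q) (0 # xs) y"
inductive_cases eval_PrimRec_SucE: "eval g (PrimRec p q) (Suc n # xs) y"
inductive_cases eval_MuE: "eval g (Mu p) xs y"

lemma eval_deterministic: "eval g p xs y \<Longrightarrow> eval g p xs z \<Longrightarrow> y = z"
proof (induction arbitrary: z rule: eval.induct)
  case (Zero xs)
  then show ?case by (blast elim: eval_ZeroE)
next
  case (Succ x)
  then show ?case by (rule eval_SuccE) simp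
next
  case (Proj i xs)
  from Proj.prems show ?case by (rule eval_ProjE) simp
next
  case (Oracle x)
  then show ?case by (rule eval_OracleE) simp
next
  case (Comp xs qs ys p z z')
  from Comp.prems obtain ys' where 1: "list_all2 (\<lambda>q y. eval g q xs y) qs ys'"
    and 2: "eval g p ys' z'"
    by (rule eval_CompE)
  have "ys = ys'"
    using Comp.IH(1) 1 by (auto simp: list_all2_conv_all_nth intro!: nth_equalityI)
  with 2 Comp.IH(2) show ?case by simp
next
  case (PrimRec_0 p xs y q)
  from PrimRec_0.prems have "eval g p xs z" by (rule eval_PrimRec_0E)
  then show ?case by (rule PrimRec_0.IH)
next
  case (PrimRec_Suc p q n xs y z z')
  from PrimRec_Suc.prems obtain y' where 1: "eval g (PrimRec p q) (n # xs) y'"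
    and 2: "eval g q (n # y' # xs) z'"
    by (rule eval_PrimRec_SucE)
  from PrimRec_Suc.IH(1)[OF 1] 2 have "eval g q (n # y # xs) z'" by simp
  then show ?case by (rule PrimRec_Suc.IH(2))
next
  case (Mu p n xs z)
  from Mu.prems have z: "eval g p (z # xs) 0" "\<And>m. m < z \<Longrightarrow> \<exists>y. eval g p (m # xs) (Suc y)"
    by (blast elim: eval_MuE)+
  show ?case
  proof (rule linorder_cases[of n z])
    assume "n < z"
    with z(2) obtain y where "eval g p (n # xs) (Suc y)" by blast
    from Mu.IH(1)[OF this] show ?thesis by simp
  next
    assume "z < n"
    with Mu.IH(2) obtain y where "\<And>w. eval g p (z # xs) w \<Longrightarrow> Suc y = w" by blast
    from this[OF z(1)] show ?thesis by simp
  qed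
qed

definition turing_le :: "(nat \<Rightarrow> nat) \<Rightarrow> (nat \<Rightarrow> nat) \<Rightarrow> bool"  (infix "\<le>\<^sub>T" 50) where
  "f \<le>\<^sub>T g \<longleftrightarrow> (\<exists>p. \<forall>n. eval g p [n] (f n))"


section \<open>Reduction concepts\<close>

text \<open>
  The underlying nonempty set is a type, so the only content is that \<open>le\<close> is a (not necessarily
  total) preorder; the distinguished element \<open>x0\<close> is arbitrary.
\<close>

definition reduction_concept :: "('a \<Rightarrow> 'a \<Rightarrow> bool) \<Rightarrow> 'a \<Rightarrow> bool" where
  "reduction_concept le x0 \<longleftrightarrow> reflp le \<and> transp le"

definition basic :: "('a \<Rightarrow> 'a \<Rightarrow> bool) \<Rightarrow> 'a \<Rightarrow> 'a \<Rightarrow> bool" where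
  "basic le x0 z \<longleftrightarrow> le z x0"

definition bounding :: "('a \<Rightarrow> 'a \<Rightarrow> bool) \<Rightarrow> 'a \<Rightarrow> ('a \<Rightarrow> 'a \<Rightarrow> bool) \<Rightarrow> 'a set" where
  "bounding le x0 R = {x. \<exists>y. le y x \<and> (\<forall>z. basic le x0 z \<longrightarrow> R z y)}"

definition non_dominated :: "('a \<Rightarrow> 'a \<Rightarrow> bool) \<Rightarrow> 'a \<Rightarrow> ('a \<Rightarrow> 'a \<Rightarrow> bool) \<Rightarrow> 'a set" where
  "non_dominated le x0 R = {x. \<exists>y. le y x \<and> (\<forall>z. basic le x0 z \<longrightarrow> \<not> R y z)}"


section \<open>The three relations\<close>

definition le_star :: "(nat \<Rightarrow> nat) \<Rightarrow> (nat \<Rightarrow> nat) \<Rightarrow> bool" where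
  "le_star f g \<longleftrightarrow> (\<forall>\<^sub>\<infinity>n. f n \<le> g n)"

definition neq_star :: "(nat \<Rightarrow> nat) \<Rightarrow> (nat \<Rightarrow> nat) \<Rightarrow> bool" where
  "neq_star f g \<longleftrightarrow> (\<forall>\<^sub>\<infinity>n. f n \<noteq> g n)"

definition slalom :: "(nat \<Rightarrow> nat set) \<Rightarrow> bool" where
  "slalom \<sigma> \<longleftrightarrow> (\<forall>n. finite (\<sigma> n) \<and> card (\<sigma> n) \<le> n)"

definition in_slalom :: "(nat \<Rightarrow> nat) \<Rightarrow> (nat \<Rightarrow> nat set) \<Rightarrow> bool" where
  "in_slalom f \<sigma> \<longleftrightarrow> (\<forall>\<^sub>\<infinity>n. f n \<in> \<sigma> n)"

text \<open>
  The computable coding of slaloms as reals: the value at \<open>n\<close> is the canonical index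
  (sum of the \<open>2 ^ i\<close> for \<open>i \<in> \<sigma> n\<close>) of the finite set \<open>\<sigma> n\<close>.
\<close>

definition slalom_code :: "(nat \<Rightarrow> nat set) \<Rightarrow> nat \<Rightarrow> nat" where
  "slalom_code \<sigma> n = set_encode (\<sigma> n)"

lemma slalom_code_inject:
  "slalom \<sigma> \<Longrightarrow> slalom \<tau> \<Longrightarrow> slalom_code \<sigma> = slalom_code \<tau> \<longleftrightarrow> \<sigma> = \<tau>"
  by (auto simp: fun_eq_iff slalom_code_def slalom_def set_encode_eq)

text \<open>
  \<open>in_star\<close> is membership in a slalom viewed as a relation on reals: its right-hand argument must
  be the code of a slalom.
\<close>

definition in_star :: "(nat \<Rightarrow> nat) \<Rightarrow> (nat \<Rightarrow> nat) \<Rightarrow> bool" where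
  "in_star f s \<longleftrightarrow> (\<exists>\<sigma>. slalom \<sigma> \<and> s = slalom_code \<sigma> \<and> in_slalom f \<sigma>)"

lemma in_star_slalom_code: "slalom \<sigma> \<Longrightarrow> in_star f (slalom_code \<sigma>) \<longleftrightarrow> in_slalom f \<sigma>"
  using slalom_code_inject by (auto simp: in_star_def)

lemma mem_bounding_in_star_iff:
  assumes "reduction_concept le x0"
  shows "x \<in> bounding le x0 in_star \<longleftrightarrow>
    (\<exists>\<sigma>. slalom \<sigma> \<and> le (slalom_code \<sigma>) x \<and> (\<forall>z. basic le x0 z \<longrightarrow> in_slalom z \<sigma>))"
proof
  assume "x \<in> bounding le x0 in_star"
  then obtain y where y: "le y x" "\<And>z. basic le x0 z \<Longrightarrow> in_star z y"
    by (auto simp: bounding_def)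
  have "basic le x0 x0"
    using assms by (simp add: basic_def reduction_concept_def reflpD)
  then obtain \<sigma> where "slalom \<sigma>" "y = slalom_code \<sigma>"
    using y(2) by (auto simp: in_star_def)
  with y show "\<exists>\<sigma>. slalom \<sigma> \<and> le (slalom_code \<sigma>) x \<and> (\<forall>z. basic le x0 z \<longrightarrow> in_slalom z \<sigma>)"
    using in_star_slalom_code by blast
qed (auto simp: bounding_def in_star_slalom_code)

lemma mem_non_dominated_in_star_iff:
  "x \<in> non_dominated le x0 in_star \<longleftrightarrow>
    (\<exists>y. le y x \<and> (\<forall>\<sigma>. slalom \<sigma> \<longrightarrow> basic le x0 (slalom_code \<sigma>) \<longrightarrow> \<not> in_slalom y \<sigma>))"
  by (auto simp: non_dominated_def in_star_def)

end

theory Submission imports Defs "HOL-Library.Infinite_Set" begin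

text \<open>
  Each inclusion, apart from that into the non-basic reals, comes from a pair of
  functionals: one turns the real testifying to membership in the smaller set into one testifying
  to membership in the larger set, the other turns each basic challenge to the new witness into a
  basic challenge to the old one. All these functionals are computable, so that their value is
  Turing reducible, hence \<open>\<sqsubseteq>\<close>-reducible, to their argument; in particular they send basic reals to
  basic reals.

  Most functionals are trivial. A member of a finite set is less than the canonical index of the
  set, so the code of a slalom dominates every real that the slalom captures, and the identity
  serves for the inclusions between \<open>\<in>\<^sup>*\<close> and \<open>\<le>\<^sup>*\<close>. If \<open>f \<le>\<^sup>* g\<close>, then \<open>Suc \<circ> g\<close> is eventually
  different from \<open>f\<close> and not dominated by \<open>f\<close>, which settles the inclusions between \<open>\<le>\<^sup>*\<close> and
  \<open>\<noteq>\<^sup>*\<close> and that from bounding to non-dominated for \<open>\<le>\<^sup>*\<close>. A basic \<open>f\<close> is captured by the basic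
  slalom of its singletons, so no basic \<open>x\<close> lies above a real that escapes all basic slaloms.

  The two remaining inclusions, from bounding for \<open>\<noteq>\<^sup>*\<close> to non-dominated for \<open>\<in>\<^sup>*\<close> and from
  bounding for \<open>\<in>\<^sup>*\<close> to non-dominated for \<open>\<noteq>\<^sup>*\<close>, are dual and rest on one argument of
  Bartoszynski. Choose disjoint blocks in \<open>\<omega>\<close>, the \<open>n\<close>-th one containing the \<open>n\<close> points
  \<open>\<langle>n, 0\<rangle>, \<dots>, \<langle>n, n - 1\<rangle>\<close>, and let \<open>block_code y n\<close> code the restriction of \<open>y\<close> to the \<open>n\<close>-th
  block. A slalom offers at most \<open>n\<close> candidates for this code, and the block has as many points,
  so one real can agree at the \<open>i\<close>-th point with the \<open>i\<close>-th candidate, for every \<open>i\<close>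
  at once. This real, \<open>guess s\<close>, is computable from the code \<open>s\<close> of the slalom, and if the slalom
  captures \<open>block_code y\<close>, it agrees with \<open>y\<close> somewhere in almost every block
  (\<open>guess_infinitely_often_correct\<close>). For the first inclusion, a \<open>y\<close> eventually different from
  all basic reals yields \<open>block_code y\<close>: a basic slalom capturing it would make the basic real
  \<open>guess s\<close> infinitely often equal to \<open>y\<close>. For the second, a slalom capturing all basic reals
  captures \<open>block_code z\<close> for every basic \<open>z\<close>, so \<open>guess s\<close> is infinitely often equal to each
  basic \<open>z\<close>.

  To make the two functionals visibly computable, finite functions are coded by the canonical
  indices of their graphs, and all decoding is done by bounded sums.
\<close>

section \<open>Closure properties of relative computability\<close>

text \<open>
  The list is the environment of variables. Throughout, variables are read off as
  \<open>hd xs\<close>, \<open>hd (tl xs)\<close>, and so on, so that a bound variable becomes the new head, as with de Bruijn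
  indices. The closure properties are then syntax-directed introduction rules whose conclusions
  match by higher-order pattern unification.
\<close>
definition recursive_in :: "(nat \<Rightarrow> nat) \<Rightarrow> nat \<Rightarrow> (nat list \<Rightarrow> nat) \<Rightarrow> bool" where
  "recursive_in g k f \<longleftrightarrow> (\<exists>p. \<forall>xs. length xs = k \<longrightarrow> eval g p xs (f xs))"

lemma recursive_in_imp_turing_le:
  assumes "recursive_in g (Suc 0) (\<lambda>xs. f (hd xs))"
  shows "f \<le>\<^sub>T g"
proof -
  obtain p where "\<And>xs. length xs = Suc 0 \<Longrightarrow> eval g p xs (f (hd xs))"
    using assms by (auto simp: recursive_in_def)
  from this[of "[_]"] show ?thesis
    by (auto simp: turing_le_def)
qed

lemma recursive_in_cong:
  assumes "recursive_in g k f" "\<And>xs. length xs = k \<Longrightarrow> f xs = f' xs"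
  shows "recursive_in g k f'"
  using assms by (auto simp: recursive_in_def)

lemma recursive_in_compose:
  assumes "recursive_in g (length hs) f" "\<And>h. h \<in> set hs \<Longrightarrow> recursive_in g k h"
  shows "recursive_in g k (\<lambda>xs. f (map (\<lambda>h. h xs) hs))"
proof -
  obtain p where p: "\<And>ys. length ys = length hs \<Longrightarrow> eval g p ys (f ys)"
    using assms(1) by (auto simp: recursive_in_def)
  obtain q where q: "\<And>h xs. h \<in> set hs \<Longrightarrow> length xs = k \<Longrightarrow> eval g (q h) xs (h xs)"
    using assms(2) unfolding recursive_in_def by metis
  have "eval g (Comp p (map q hs)) xs (f (map (\<lambda>h. h xs) hs))" if "length xs = k" for xs
    using p[of "map (\<lambda>h. h xs) hs"] q[OF _ that]
    by (intro eval.Comp[of g xs "map q hs" "map (\<lambda>h. h xs) hs"])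
       (auto simp: list_all2_conv_all_nth)
  then show ?thesis by (auto simp: recursive_in_def)
qed

lemma recursive_in_nth: "i < k \<Longrightarrow> recursive_in g k (\<lambda>xs. xs ! i)"
  unfolding recursive_in_def by (auto intro: eval.Proj)

lemma recursive_in_var:
  "recursive_in g (Suc k) (\<lambda>xs. hd xs)"
  "recursive_in g (Suc (Suc k)) (\<lambda>xs. hd (tl xs))"
  "recursive_in g (Suc (Suc (Suc k))) (\<lambda>xs. hd (tl (tl xs)))"
  by (rule recursive_in_cong[OF recursive_in_nth[of 0]], simp,
      force simp: length_Suc_conv)
     (rule recursive_in_cong[OF recursive_in_nth[of 1]], simp,
      force simp: length_Suc_conv,
      rule recursive_in_cong[OF recursive_in_nth[of 2]], simp,
      force simp: length_Suc_conv numeral_2_eq_2)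

text \<open>
  Substitution for the bound variable combined with weakening by the first \<open>j\<close> variables. Taking
  \<open>j = 0\<close> gives plain substitution; taking \<open>j = 2\<close> drops the two variables bound by a recursion
  step.
\<close>
lemma recursive_in_shift:
  assumes "recursive_in g (Suc k) (\<lambda>ys. F (hd ys) (tl ys))" "recursive_in g (j + k) a"
  shows "recursive_in g (j + k) (\<lambda>ys. F (a ys) (drop j ys))"
proof -
  let ?hs = "a # map (\<lambda>i ys. ys ! (j + i)) [0..<k]"
  have "recursive_in g (j + k) (\<lambda>xs. (\<lambda>ys. F (hd ys) (tl ys)) (map (\<lambda>h. h xs) ?hs))"
    by (rule recursive_in_compose) (use assms in \<open>auto intro!: recursive_in_nth\<close>)
  then show ?thesis
  proof (rule recursive_in_cong)
    fix ys :: "nat list" assume "length ys = j + k"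
    then have "map (\<lambda>h. h ys) (map (\<lambda>i ys. ys ! (j + i)) [0..<k]) = drop j ys"
      by (auto intro!: nth_equalityI)
    then show "F (hd (map (\<lambda>h. h ys) ?hs)) (tl (map (\<lambda>h. h ys) ?hs)) = F (a ys) (drop j ys)"
      by simp
  qed
qed

lemma recursive_in_Suc:
  "recursive_in g k a \<Longrightarrow> recursive_in g k (\<lambda>xs. Suc (a xs))"
  using recursive_in_compose[of g "[a]" "\<lambda>ys. Suc (hd ys)" k]
  by (fastforce simp: recursive_in_def length_Suc_conv intro: eval.Succ)

lemma recursive_in_oracle:
  "recursive_in g k a \<Longrightarrow> recursive_in g k (\<lambda>xs. g (a xs))"
  using recursive_in_compose[of g "[a]" "\<lambda>ys. g (hd ys)" k]
  by (fastforce simp: recursive_in_def length_Suc_conv intro: eval.Oracle)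

lemma recursive_in_const: "recursive_in g k (\<lambda>xs. c)"
proof (induction c)
  case 0
  show ?case unfolding recursive_in_def by (auto intro: eval.Zero)
qed (rule recursive_in_Suc)

lemma recursive_in_rec_nat:
  assumes "recursive_in g k b"
    and "recursive_in g (Suc (Suc k)) (\<lambda>ys. s (hd ys) (hd (tl ys)) (tl (tl ys)))"
    and "recursive_in g k n"
  shows "recursive_in g k (\<lambda>xs. rec_nat (b xs) (\<lambda>m r. s m r xs) (n xs))"
proof -
  obtain p where p: "\<And>xs. length xs = k \<Longrightarrow> eval g p xs (b xs)"
    using assms(1) by (auto simp: recursive_in_def)
  obtain q where q: "\<And>ys. length ys = Suc (Suc k) \<Longrightarrow>
      eval g q ys (s (hd ys) (hd (tl ys)) (tl (tl ys)))"
    using assms(2) by (auto simp: recursive_in_def)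
  have "eval g (PrimRec p q) (m # xs) (rec_nat (b xs) (\<lambda>m r. s m r xs) m)"
    if "length xs = k" for m xs
  proof (induction m)
    case 0
    show ?case using p[OF that] by (simp add: eval.PrimRec_0)
  next
    case (Suc m)
    then show ?case
      using q[of "m # rec_nat (b xs) (\<lambda>m r. s m r xs) m # xs"] that
      by (auto intro: eval.PrimRec_Suc)
  qed
  then have "recursive_in g (Suc k) (\<lambda>ys. rec_nat (b (tl ys)) (\<lambda>m r. s m r (tl ys)) (hd ys))"
    by (auto simp: recursive_in_def length_Suc_conv intro!: exI[of _ "PrimRec p q"])
  from recursive_in_shift[where F = "\<lambda>m xs. rec_nat (b xs) (\<lambda>m r. s m r xs) m" and j = 0, OF this]
  show ?thesis using assms(3) by simp
qed

lemma recursive_in_add: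
  assumes "recursive_in g k a" "recursive_in g k b"
  shows "recursive_in g k (\<lambda>xs. a xs + b xs)"
proof -
  have "rec_nat m (\<lambda>_ r. Suc r) n = m + n" for m n by (induction n) auto
  then show ?thesis
    using recursive_in_rec_nat[of g k a "\<lambda>m r xs. Suc r" b] assms
    by (simp add: recursive_in_Suc recursive_in_var)
qed

lemma recursive_in_sum:
  assumes "recursive_in g k b" "recursive_in g (Suc k) (\<lambda>ys. F (hd ys) (tl ys))"
  shows "recursive_in g k (\<lambda>xs. \<Sum>j<b xs. F j xs)"
proof -
  have "rec_nat 0 (\<lambda>j r. r + h j) n = (\<Sum>j<n. h j)" for h :: "nat \<Rightarrow> nat" and n
    by (induction n) auto
  moreover have "recursive_in g (Suc (Suc k)) (\<lambda>ys. F (hd ys) (tl (tl ys)))"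
    using recursive_in_shift[where F = F and j = 2, OF assms(2)] recursive_in_var(1)
    by (simp add: drop_Suc numeral_2_eq_2)
  ultimately show ?thesis
    using recursive_in_rec_nat[of g k "\<lambda>_. 0" "\<lambda>j r xs. r + F j xs" b] assms(1)
    by (simp add: recursive_in_const recursive_in_add recursive_in_var)
qed

text \<open>
  These lifting rules reduce closure under a fixed operation to the case where its arguments are
  variables.
\<close>
lemma recursive_in_lift1:
  assumes "recursive_in g (Suc 0) (\<lambda>ys. f (hd ys))" "recursive_in g k a"
  shows "recursive_in g k (\<lambda>xs. f (a xs))"
  using recursive_in_compose[of g "[a]" "\<lambda>ys. f (hd ys)" k] assms by simp

lemma recursive_in_lift2:
  assumes "recursive_in g (Suc (Suc 0)) (\<lambda>ys. f (hd ys) (hd (tl ys)))"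
    and "recursive_in g k a" "recursive_in g k b"
  shows "recursive_in g k (\<lambda>xs. f (a xs) (b xs))"
  using recursive_in_compose[of g "[a, b]" "\<lambda>ys. f (hd ys) (hd (tl ys))" k] assms by auto

lemmas recursive_in_basic =
  recursive_in_const recursive_in_var recursive_in_Suc recursive_in_add recursive_in_sum

lemma recursive_in_mult:
  assumes "recursive_in g k a" "recursive_in g k b"
  shows "recursive_in g k (\<lambda>xs. a xs * b xs)"
proof (rule recursive_in_lift2[OF _ assms])
  have "recursive_in g (Suc (Suc 0)) (\<lambda>ys. \<Sum>j<hd (tl ys). hd ys)"
    by (intro recursive_in_basic)
  then show "recursive_in g (Suc (Suc 0)) (\<lambda>ys. hd ys * hd (tl ys))"
    by (simp add: mult.commute)
qed

lemma recursive_in_diff: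
  assumes "recursive_in g k a" "recursive_in g k b"
  shows "recursive_in g k (\<lambda>xs. a xs - b xs)"
proof (rule recursive_in_lift2[OF _ assms])
  have pred: "recursive_in g k (\<lambda>xs. c xs - 1)" if "recursive_in g k c" for c k
  proof -
    have "rec_nat 0 (\<lambda>m _. m) n = n - 1" for n by (cases n) auto
    then show ?thesis
      using recursive_in_rec_nat[of g k "\<lambda>_. 0" "\<lambda>m r xs. m" c] that
      by (simp add: recursive_in_basic)
  qed
  have "rec_nat m (\<lambda>_ r. r - 1) n = m - n" for m n by (induction n) auto
  then show "recursive_in g (Suc (Suc 0)) (\<lambda>ys. hd ys - hd (tl ys))"
    using recursive_in_rec_nat[of g "Suc (Suc 0)" "\<lambda>ys. hd ys" "\<lambda>m r xs. r - 1" "\<lambda>ys. hd (tl ys)"]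
      pred[OF recursive_in_var(2)]
    by (simp add: recursive_in_basic)
qed

lemma recursive_in_power2:
  assumes "recursive_in g k a"
  shows "recursive_in g k (\<lambda>xs. 2 ^ a xs)"
proof -
  have "rec_nat 1 (\<lambda>_ r. r + r) n = (2::nat) ^ n" for n by (induction n) auto
  then show ?thesis
    using recursive_in_rec_nat[of g k "\<lambda>_. 1" "\<lambda>m r xs. r + r" a] assms
    by (simp add: recursive_in_basic)
qed

lemma recursive_in_le:
  assumes "recursive_in g k a" "recursive_in g k b"
  shows "recursive_in g k (\<lambda>xs. of_bool (a xs \<le> b xs))"
proof -
  have "recursive_in g k (\<lambda>xs. 1 - (a xs - b xs))"
    by (intro recursive_in_diff recursive_in_basic assms)
  then show ?thesis by (rule recursive_in_cong) auto
qed

lemma recursive_in_eq: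
  assumes "recursive_in g k a" "recursive_in g k b"
  shows "recursive_in g k (\<lambda>xs. of_bool (a xs = b xs))"
proof -
  have "recursive_in g k (\<lambda>xs. of_bool (a xs \<le> b xs) * of_bool (b xs \<le> a xs))"
    by (intro recursive_in_mult recursive_in_le assms)
  then show ?thesis by (rule recursive_in_cong) auto
qed

text \<open>
  The device behind decoding: a sum bounded by something computable, in which
  an indicator leaves only the wanted term.
\<close>
lemma sum_of_bool_eq:
  fixes b :: nat
  assumes "c < b" "\<And>j. j < b \<Longrightarrow> P j \<longleftrightarrow> j = c"
  shows "(\<Sum>j<b. f j * of_bool (P j)) = (f c :: nat)"
proof -
  have "(\<Sum>j<b. f j * of_bool (P j)) = (\<Sum>j<b. if j = c then f j else 0)"
    using assms(2) by (intro sum.cong) auto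
  then show ?thesis using assms(1) by simp
qed

text \<open>
  For positive \<open>n\<close> the quotient \<open>m div n\<close> is the number of \<open>j < m\<close> with \<open>(j + 1) n \<le> m\<close>.
\<close>
lemma recursive_in_div:
  assumes "recursive_in g k a" "recursive_in g k b" "\<And>xs. b xs > 0"
  shows "recursive_in g k (\<lambda>xs. a xs div b xs)"
proof -
  have "recursive_in g k (\<lambda>xs. (\<lambda>m n. \<Sum>j<m. of_bool (Suc j * n \<le> m)) (a xs) (b xs))"
    by (rule recursive_in_lift2[OF _ assms(1,2)])
      (intro recursive_in_mult recursive_in_le recursive_in_basic)
  moreover have "(\<Sum>j<m. of_bool (Suc j * n \<le> m)) = m div n" if "n > 0" for m n :: nat
  proof -
    have iff: "Suc j * n \<le> m \<longleftrightarrow> j < m div n" for j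
      using less_eq_div_iff_mult_less_eq[OF that, of "Suc j" m] by (simp only: Suc_le_eq)
    have "{..<m} \<inter> {j. j < m div n} = {..<m div n}"
      by (auto intro: less_le_trans[OF _ div_le_dividend])
    then show ?thesis
      unfolding iff of_bool_def by (simp add: sum.If_cases)
  qed
  ultimately show ?thesis using assms(3) by (simp del: mult_Suc)
qed

lemma recursive_in_mem_set_decode:
  assumes "recursive_in g k a" "recursive_in g k b"
  shows "recursive_in g k (\<lambda>xs. of_bool (a xs \<in> set_decode (b xs)))"
proof -
  have "recursive_in g k (\<lambda>xs. b xs div 2 ^ a xs - 2 * (b xs div 2 ^ a xs div 2))"
    by (intro recursive_in_diff recursive_in_mult recursive_in_div recursive_in_power2
        recursive_in_const assms) auto
  then show ?thesis
    by (rule recursive_in_cong) (simp add: set_decode_def minus_mult_div_eq_mod mod2_eq_if)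
qed

lemma recursive_in_prod_encode:
  assumes "recursive_in g k a" "recursive_in g k b"
  shows "recursive_in g k (\<lambda>xs. prod_encode (a xs, b xs))"
proof -
  have "recursive_in g k (\<lambda>xs. (\<Sum>j<Suc (a xs + b xs). j) + a xs)"
    by (intro recursive_in_basic assms)
  moreover have "triangle n = (\<Sum>j<Suc n. j)" for n
    by (induction n) auto
  ultimately show ?thesis by (simp only: prod_encode_def prod.case)
qed

text \<open>
  Both components of a pair are bounded by its code, so a double sum over all candidates finds
  them.
\<close>
lemma recursive_in_prod_decode:
  assumes "recursive_in g k a"
  shows "recursive_in g k (\<lambda>xs. fst (prod_decode (a xs)))"
    and "recursive_in g k (\<lambda>xs. snd (prod_decode (a xs)))"
proof -
  let ?P = "\<lambda>m j i. prod_encode (j, i) = m"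
  have *: "(\<Sum>j<Suc m. \<Sum>i<Suc m. h j i * of_bool (?P m j i))
      = h (fst (prod_decode m)) (snd (prod_decode m))" for h :: "nat \<Rightarrow> nat \<Rightarrow> nat" and m
  proof -
    obtain u v where uv: "prod_decode m = (u, v)" by force
    then have m: "m = prod_encode (u, v)" by (metis prod_decode_inverse)
    have le: "u < Suc m" "v < Suc m"
      unfolding m less_Suc_eq_le by (rule le_prod_encode_1 le_prod_encode_2)+
    have "(\<Sum>j<Suc m. \<Sum>i<Suc m. h j i * of_bool (?P m j i))
        = (\<Sum>j<Suc m. (\<Sum>i<Suc m. h j i * of_bool (i = v)) * of_bool (j = u))"
      unfolding sum_distrib_right by (intro sum.cong) (auto simp: m prod_encode_eq)
    also have "\<dots> = h u v"
      using le by (simp only: sum_of_bool_eq)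
    finally show ?thesis by (simp add: uv)
  qed
  show "recursive_in g k (\<lambda>xs. fst (prod_decode (a xs)))"
    unfolding *[of "\<lambda>j i. j", symmetric]
    by (rule recursive_in_lift1[OF _ assms])
      (intro recursive_in_mult recursive_in_eq recursive_in_prod_encode recursive_in_basic)
  show "recursive_in g k (\<lambda>xs. snd (prod_decode (a xs)))"
    unfolding *[of "\<lambda>j i. i", symmetric]
    by (rule recursive_in_lift1[OF _ assms])
      (intro recursive_in_mult recursive_in_eq recursive_in_prod_encode recursive_in_basic)
qed

lemmas recursive_in_intros =
  recursive_in_basic recursive_in_mult recursive_in_power2 recursive_in_le recursive_in_eq
  recursive_in_mem_set_decode recursive_in_prod_encode recursive_in_prod_decode recursive_in_oracle

section \<open>Guessing the blocks of a real from a slalom\<close>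

text \<open>
  The canonical index of the graph of \<open>i \<mapsto> y \<langle>n, i\<rangle>\<close>, for \<open>i < n\<close>.
\<close>
definition block_code :: "(nat \<Rightarrow> nat) \<Rightarrow> nat \<Rightarrow> nat" where
  "block_code y n = (\<Sum>i<n. 2 ^ prod_encode (i, y (prod_encode (n, i))))"

text \<open>
  The value at \<open>i\<close> of the finite function whose graph has canonical index \<open>e\<close>. Every value of that
  function is less than \<open>e\<close>, which justifies the bound.
\<close>
definition component :: "nat \<Rightarrow> nat \<Rightarrow> nat" where
  "component e i = (\<Sum>v<e. v * of_bool (prod_encode (i, v) \<in> set_decode e))"

text \<open>
  The component at \<open>i\<close> of the \<open>i\<close>-th element \<open>e\<close>, in increasing order, of the finite set with
  canonical index \<open>u\<close>. The last factor recognises the \<open>i\<close>-th element as the one with exactly \<open>i\<close>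
  elements of the set below it. The value is \<open>0\<close> if the set has at most \<open>i\<close> elements.
\<close>
definition diagonal :: "nat \<Rightarrow> nat \<Rightarrow> nat" where
  "diagonal u i = (\<Sum>e<u. component e i *
     of_bool (e \<in> set_decode u) * of_bool ((\<Sum>j<e. of_bool (j \<in> set_decode u)) = i))"

definition guess :: "(nat \<Rightarrow> nat) \<Rightarrow> nat \<Rightarrow> nat" where
  "guess s m = diagonal (s (fst (prod_decode m))) (snd (prod_decode m))"

lemma block_code_turing_le: "block_code y \<le>\<^sub>T y"
  by (rule recursive_in_imp_turing_le) (unfold block_code_def, intro recursive_in_intros)

lemma recursive_in_component:
  assumes "recursive_in g k a" "recursive_in g k b"
  shows "recursive_in g k (\<lambda>xs. component (a xs) (b xs))"
  by (rule recursive_in_lift2[of g component, OF _ assms])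
    (unfold component_def, intro recursive_in_intros)

lemma recursive_in_diagonal:
  assumes "recursive_in g k a" "recursive_in g k b"
  shows "recursive_in g k (\<lambda>xs. diagonal (a xs) (b xs))"
  by (rule recursive_in_lift2[of g diagonal, OF _ assms])
    (unfold diagonal_def, intro recursive_in_intros recursive_in_component)

lemma guess_turing_le: "guess s \<le>\<^sub>T s"
  by (rule recursive_in_imp_turing_le)
    (unfold guess_def, intro recursive_in_diagonal recursive_in_intros)

text \<open>
  The canonical index is a sum of powers of two and \<open>a < 2 ^ a\<close>. Besides bounding the sums used for
  decoding, this makes the code of a slalom a bound for every real that the slalom captures.
\<close>
lemma less_set_encode:
  assumes "finite A" "a \<in> A"
  shows "a < set_encode A"
proof -
  have "a < 2 ^ a" by simp
  also have "\<dots> \<le> set_encode A"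
    unfolding set_encode_def using assms by (intro member_le_sum) auto
  finally show ?thesis .
qed

lemma component_block_code:
  assumes "i < n"
  shows "component (block_code y n) i = y (prod_encode (n, i))"
proof -
  let ?D = "(\<lambda>i. prod_encode (i, y (prod_encode (n, i)))) ` {..<n}"
  have code: "block_code y n = set_encode ?D"
    unfolding block_code_def set_encode_def
    by (subst sum.reindex) (auto simp: inj_on_def prod_encode_eq)
  have "prod_encode (i, y (prod_encode (n, i))) < block_code y n"
    unfolding code by (rule less_set_encode) (use assms in auto)
  then have "y (prod_encode (n, i)) < block_code y n"
    using le_prod_encode_2 by (rule le_less_trans[rotated])
  then show ?thesis
    unfolding component_def
    by (rule sum_of_bool_eq) (use assms in \<open>auto simp: code prod_encode_eq\<close>)
qed

text \<open>
  The witness \<open>i\<close> is the number of elements of \<open>A\<close> below \<open>e\<close>; counting elements below is strictly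
  increasing on \<open>A\<close>, so \<open>e\<close> is the only element selected at \<open>i\<close>.
\<close>
lemma diagonal_hits_every_element:
  assumes "finite A" "e \<in> A"
  shows "\<exists>i<card A. diagonal (set_encode A) i = component e i"
proof -
  define rank where "rank d = card {j\<in>A. j < d}" for d
  have rank: "(\<Sum>j<d. of_bool (j \<in> A)) = rank d" for d
  proof -
    have "{..<d} \<inter> {j. j \<in> A} = {j\<in>A. j < d}" by auto
    then show ?thesis by (simp add: rank_def of_bool_def sum.If_cases)
  qed
  have mono: "rank c < rank d" if "c \<in> A" "c < d" for c d
    unfolding rank_def using assms(1) that by (intro psubset_card_mono) auto
  have "rank d = rank e \<longleftrightarrow> d = e" if "d \<in> A" for d
    using mono[OF that, of e] mono[OF assms(2), of d] by (cases d e rule: linorder_cases) auto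
  then have "diagonal (set_encode A) (rank e) = component e (rank e)"
    using assms unfolding diagonal_def mult.assoc of_bool_conj[symmetric]
    by (intro sum_of_bool_eq less_set_encode) (auto simp: rank)
  moreover have "rank e < card A"
    unfolding rank_def using assms by (intro psubset_card_mono) auto
  ultimately show ?thesis by blast
qed

text \<open>
  If \<open>block_code y n \<in> \<sigma> n\<close>, this code is the \<open>i\<close>-th element of \<open>\<sigma> n\<close> for some \<open>i < n\<close>, since
  \<open>\<sigma> n\<close> has at most \<open>n\<close> elements; so the guess is correct at the \<open>i\<close>-th point of the \<open>n\<close>-th block.
  That point is at least \<open>n\<close>, hence such points are unbounded.
\<close>
lemma guess_infinitely_often_correct:
  assumes "slalom \<sigma>" "in_slalom (block_code y) \<sigma>"
  shows "\<not> neq_star (guess (slalom_code \<sigma>)) y"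
proof
  assume "neq_star (guess (slalom_code \<sigma>)) y"
  then obtain M where M: "\<And>m. m \<ge> M \<Longrightarrow> guess (slalom_code \<sigma>) m \<noteq> y m"
    by (auto simp: neq_star_def MOST_nat_le)
  obtain N where N: "\<And>n. n \<ge> N \<Longrightarrow> block_code y n \<in> \<sigma> n"
    using assms(2) by (auto simp: in_slalom_def MOST_nat_le)
  define n where "n = max M N"
  have fin: "finite (\<sigma> n)" "card (\<sigma> n) \<le> n"
    using assms(1) by (auto simp: slalom_def)
  then obtain i where i: "i < n"
      "diagonal (set_encode (\<sigma> n)) i = component (block_code y n) i"
    using diagonal_hits_every_element[OF fin(1) N] by (auto simp: n_def dest: less_le_trans)
  then have "guess (slalom_code \<sigma>) (prod_encode (n, i)) = y (prod_encode (n, i))"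
    by (simp add: guess_def slalom_code_def component_block_code)
  moreover have "M \<le> prod_encode (n, i)"
    using le_prod_encode_1[of n i] by (simp add: n_def)
  ultimately show False using M by blast
qed

section \<open>The simple witnesses\<close>

lemma in_star_imp_le_star: "in_star f s \<Longrightarrow> le_star f s"
  unfolding in_star_def le_star_def in_slalom_def slalom_def slalom_code_def
  by (elim exE conjE, erule MOST_mono) (simp add: less_imp_le less_set_encode)

lemma Suc_comp_turing_le: "Suc \<circ> f \<le>\<^sub>T f"
  by (rule recursive_in_imp_turing_le) (unfold comp_def, intro recursive_in_intros)

lemma le_star_imp_neq_star_Suc_comp:
  assumes "le_star f g"
  shows "neq_star f (Suc \<circ> g)" and "neq_star (Suc \<circ> g) f"
  using assms unfolding le_star_def neq_star_def by - (erule MOST_mono; simp)+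

lemma le_star_imp_not_Suc_comp_le_star:
  assumes "le_star f g"
  shows "\<not> le_star (Suc \<circ> g) f"
proof
  assume "le_star (Suc \<circ> g) f"
  with assms have "\<forall>\<^sub>\<infinity>n. f n \<le> g n \<and> Suc (g n) \<le> f n"
    unfolding le_star_def comp_def by (rule MOST_conjI)
  then show False
    using MOST_mono[of _ "\<lambda>_. False"] by force
qed

text \<open>
  A slalom must be empty at \<open>0\<close>.
\<close>
definition singleton_slalom :: "(nat \<Rightarrow> nat) \<Rightarrow> nat \<Rightarrow> nat set" where
  "singleton_slalom f n = (if n = 0 then {} else {f n})"

lemma slalom_singleton_slalom: "slalom (singleton_slalom f)"
  by (simp add: slalom_def singleton_slalom_def)

lemma in_slalom_singleton_slalom: "in_slalom f (singleton_slalom f)"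
  unfolding in_slalom_def MOST_nat by (auto simp: singleton_slalom_def)

lemma singleton_slalom_turing_le: "slalom_code (singleton_slalom f) \<le>\<^sub>T f"
proof -
  have "slalom_code (singleton_slalom f) = (\<lambda>n. of_bool (1 \<le> n) * 2 ^ f n)"
    by (auto simp: slalom_code_def singleton_slalom_def set_encode_def)
  then show ?thesis
    by (intro recursive_in_imp_turing_le) (simp only:, intro recursive_in_intros)
qed

section \<open>The diagram of inclusions\<close>

theorem theorem2p7:
  fixes le :: "(nat \<Rightarrow> nat) \<Rightarrow> (nat \<Rightarrow> nat) \<Rightarrow> bool"  (infix "\<sqsubseteq>" 50)
    and x0 :: "nat \<Rightarrow> nat"
  assumes "reduction_concept (\<sqsubseteq>) x0"
    and "\<And>x y. x \<le>\<^sub>T y \<Longrightarrow> x \<sqsubseteq> y"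
    and "\<And>f g h. f \<sqsubseteq> h \<Longrightarrow> g \<sqsubseteq> h \<Longrightarrow> f \<circ> g \<sqsubseteq> h"
  shows "{} \<subseteq> bounding (\<sqsubseteq>) x0 in_star
    \<and> bounding (\<sqsubseteq>) x0 in_star \<subseteq> bounding (\<sqsubseteq>) x0 le_star
    \<and> bounding (\<sqsubseteq>) x0 le_star \<subseteq> bounding (\<sqsubseteq>) x0 neq_star
    \<and> bounding (\<sqsubseteq>) x0 neq_star \<subseteq> non_dominated (\<sqsubseteq>) x0 in_star
    \<and> non_dominated (\<sqsubseteq>) x0 in_star \<subseteq> UNIV - {x. x \<sqsubseteq> x0}
    \<and> bounding (\<sqsubseteq>) x0 in_star \<subseteq> non_dominated (\<sqsubseteq>) x0 neq_star
    \<and> non_dominated (\<sqsubseteq>) x0 neq_star \<subseteq> non_dominated (\<sqsubseteq>) x0 le_star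
    \<and> non_dominated (\<sqsubseteq>) x0 le_star \<subseteq> non_dominated (\<sqsubseteq>) x0 in_star
    \<and> bounding (\<sqsubseteq>) x0 le_star \<subseteq> non_dominated (\<sqsubseteq>) x0 le_star"
proof (intro conjI)
  have trans: "x \<sqsubseteq> z" if "x \<sqsubseteq> y" "y \<sqsubseteq> z" for x y z
    using assms(1) that by (auto simp: reduction_concept_def dest: transpD)
  have below: "x \<sqsubseteq> z" if "x \<le>\<^sub>T y" "y \<sqsubseteq> z" for x y z
    using trans assms(2) that by blast
  show "{} \<subseteq> bounding (\<sqsubseteq>) x0 in_star" by simp
  show "bounding (\<sqsubseteq>) x0 in_star \<subseteq> bounding (\<sqsubseteq>) x0 le_star"
    by (auto simp: bounding_def intro: in_star_imp_le_star)
  show "non_dominated (\<sqsubseteq>) x0 le_star \<subseteq> non_dominated (\<sqsubseteq>) x0 in_star"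
    by (auto simp: non_dominated_def dest: in_star_imp_le_star)
  \<comment> \<open>The next two use the same functional on different sides: here the successor is applied to the
    bound, then to the basic real.\<close>
  show "bounding (\<sqsubseteq>) x0 le_star \<subseteq> bounding (\<sqsubseteq>) x0 neq_star"
    unfolding bounding_def
    by (blast intro: below[OF Suc_comp_turing_le] le_star_imp_neq_star_Suc_comp)
  show "non_dominated (\<sqsubseteq>) x0 neq_star \<subseteq> non_dominated (\<sqsubseteq>) x0 le_star"
    unfolding non_dominated_def basic_def
    by (blast intro: below[OF Suc_comp_turing_le] le_star_imp_neq_star_Suc_comp)
  show "bounding (\<sqsubseteq>) x0 le_star \<subseteq> non_dominated (\<sqsubseteq>) x0 le_star"
    unfolding bounding_def non_dominated_def
    by (blast intro: below[OF Suc_comp_turing_le] dest: le_star_imp_not_Suc_comp_le_star)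
  show "non_dominated (\<sqsubseteq>) x0 in_star \<subseteq> UNIV - {x. x \<sqsubseteq> x0}"
    unfolding mem_non_dominated_in_star_iff subset_iff basic_def
    using slalom_singleton_slalom in_slalom_singleton_slalom
    by (blast intro: below[OF singleton_slalom_turing_le] trans)
  show "bounding (\<sqsubseteq>) x0 neq_star \<subseteq> non_dominated (\<sqsubseteq>) x0 in_star"
  proof
    fix x assume "x \<in> bounding (\<sqsubseteq>) x0 neq_star"
    then obtain y where y: "y \<sqsubseteq> x" "\<And>z. z \<sqsubseteq> x0 \<Longrightarrow> neq_star z y"
      by (auto simp: bounding_def basic_def)
    have "\<not> in_slalom (block_code y) \<sigma>" if "slalom \<sigma>" "slalom_code \<sigma> \<sqsubseteq> x0" for \<sigma>
      using guess_infinitely_often_correct[OF that(1)] y(2)[OF below[OF guess_turing_le that(2)]]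
      by blast
    moreover have "block_code y \<sqsubseteq> x"
      using block_code_turing_le y(1) by (rule below)
    ultimately show "x \<in> non_dominated (\<sqsubseteq>) x0 in_star"
      unfolding mem_non_dominated_in_star_iff basic_def by blast
  qed
  show "bounding (\<sqsubseteq>) x0 in_star \<subseteq> non_dominated (\<sqsubseteq>) x0 neq_star"
  proof
    fix x assume "x \<in> bounding (\<sqsubseteq>) x0 in_star"
    then obtain \<sigma> where \<sigma>: "slalom \<sigma>" "slalom_code \<sigma> \<sqsubseteq> x" "\<And>z. z \<sqsubseteq> x0 \<Longrightarrow> in_slalom z \<sigma>"
      unfolding mem_bounding_in_star_iff[OF assms(1)] basic_def by blast
    have "\<not> neq_star (guess (slalom_code \<sigma>)) z" if "z \<sqsubseteq> x0" for z
      using \<sigma>(1) \<sigma>(3)[OF below[OF block_code_turing_le that]]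
      by (rule guess_infinitely_often_correct)
    moreover have "guess (slalom_code \<sigma>) \<sqsubseteq> x"
      using guess_turing_le \<sigma>(2) by (rule below)
    ultimately show "x \<in> non_dominated (\<sqsubseteq>) x0 neq_star"
      unfolding non_dominated_def basic_def by blast
  qed
qed

end
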